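(* Let $x,y,\mu:M\to\mathbb C$ be smooth with $x\ne y$ everywhere, $W=W(x(w),y(w))$, and let $f$ be the map given by $$f(w)=\frac{\mu W+\bar\mu\,\overline W}{2},\qquad |\mu|^2\langle W,\overline W\rangle^{\mathbb C}=2 .$$ Let $\nu$ be the map given by $$\nu(w)=\frac{\mu W-\bar\mu\,\overline W}{2i}.$$ Then $(M,f)$ is a parametric surface of a scaled $\mathbb S^3_1(1)$ equipped with Gauss map $(M,\nu)$ if and only if the following equations are satisfied: $$\frac{\mu_w}{\mu}=-\frac{\langle W_w,\overline W\rangle^{\mathbb C}}{\langle W,\overline W\rangle^{\mathbb C}},\qquad \frac{\mu_{\bar w}}{\mu}=-\frac{\langle W_{\bar w},\overline W\rangle^{\mathbb C}}{\langle W,\overline W\rangle^{\mathbb C}}.$$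
   Context: $\mathbb R^4_1$ is $\mathbb R^4$ with $\langle p,q\rangle=-p^1q^1+p^2q^2+p^3q^3+p^4q^4$, oriented by its canonical basis and time-oriented by the first basis vector; $\mathbb S^3_1(1)=\{p:\langle p,p\rangle=1\}$, and a scaled $\mathbb S^3_1(1)$ is $\{p:\langle p,p\rangle=r\}$ for a constant $r>0$; $\langle\cdot,\cdot\rangle^{\mathbb C}$ is the complex bilinear extension to $\mathbb C^4$. $M\subset\mathbb C$ is open, connected and simply connected, $w=u+iv$, $\partial_w=\frac12(\partial_u-i\partial_v)$, $\partial_{\bar w}=\frac12(\partial_u+i\partial_v)$. For $x\neq y$ in $\mathbb C$, $W(x,y)=(1+x\bar y,\,x+\bar y,\,-i(x-\bar y),\,-1+x\bar y)$; it satisfies $\langle W,W\rangle^{\mathbb C}=0$ and $\langle W,\overline W\rangle^{\mathbb C}=2|x-y|^2$. $(M,f)$ is a (timelike) parametric surface of $\mathbb S^3_1(1)$ when $f:M\to\mathbb R^4_1$ is smooth, is a homeomorphism onto its image, has $f_u,f_v$ linearly independent at each point, satisfies $\langle f,f\rangle=1$, and has Lorentzian induced metric, i.e. $\langle f_u,f_u\rangle\langle f_v,f_v\rangle-\langle f_u,f_v\rangle^2<0$ (if the coordinates $u,v$ are null, $f_u$ and $f_v$ are taken future directed). Its Gauss map is the map $\nu$ with $\langle\nu,\nu\rangle=1$, $\langle\nu,f\rangle=\langle\nu,f_u\rangle=\langle\nu,f_v\rangle=0$, and $\{f,f_u,f_v,\nu\}$ a positively oriented basis of $\mathbb R^4_1$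 at each point; then $\nu_u,\nu_v\in\operatorname{Span}\{f_u,f_v\}$ (the spherical condition). For a scaled $\mathbb S^3_1(1)$ the value $1$ of $\langle f,f\rangle$ and $\langle\nu,\nu\rangle$ is replaced by the constant $r>0$. The Gauss map is assumed throughout to be non-constant.
   Formalization: Added assumptions, without which "if" fails: f is an immersion and a homeomorphism onto its image; f_u, f_v are future directed if u, v are null; {f, f_u, f_v, ν} is positively oriented at one point of M. All follow from the surface/Gauss map side. *)

theory Defs
  imports "HOL-Analysis.Analysis"
begin

section \<open>Smooth maps and partial derivatives in the plane\<close>

(* Derivatives are real Frechet derivatives at interior points, so all notions below are meant
   for open S and depend only on the values of the map on S. *)
primrec Ck_on :: "nat \<Rightarrow> 'a::real_normed_vector set \<Rightarrow> ('a \<Rightarrow> 'b::real_normed_vector) \<Rightarrow> bool" where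
  "Ck_on 0 S g \<longleftrightarrow> continuous_on S g"
| "Ck_on (Suc k) S g \<longleftrightarrow>
     (\<forall>p\<in>S. g differentiable (at p)) \<and> (\<forall>h. Ck_on k S (\<lambda>p. frechet_derivative g (at p) h))"

definition smooth_on :: "'a::real_normed_vector set \<Rightarrow> ('a \<Rightarrow> 'b::real_normed_vector) \<Rightarrow> bool" where
  "smooth_on S g \<longleftrightarrow> (\<forall>k. Ck_on k S g)"

definition partial_u :: "(complex \<Rightarrow> 'b::real_normed_vector) \<Rightarrow> complex \<Rightarrow> 'b" where
  "partial_u g p = frechet_derivative g (at p) 1"

definition partial_v :: "(complex \<Rightarrow> 'b::real_normed_vector) \<Rightarrow> complex \<Rightarrow> 'b" where
  "partial_v g p = frechet_derivative g (at p) \<i>"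

definition partial_w :: "(complex \<Rightarrow> complex) \<Rightarrow> complex \<Rightarrow> complex" where
  "partial_w g p = (partial_u g p - \<i> * partial_v g p) / 2"

definition partial_wbar :: "(complex \<Rightarrow> complex) \<Rightarrow> complex \<Rightarrow> complex" where
  "partial_wbar g p = (partial_u g p + \<i> * partial_v g p) / 2"

definition vec_partial_w :: "(complex \<Rightarrow> complex^4) \<Rightarrow> complex \<Rightarrow> complex^4" where
  "vec_partial_w G p = (\<chi> i. partial_w (\<lambda>q. G q $ i) p)"

definition vec_partial_wbar :: "(complex \<Rightarrow> complex^4) \<Rightarrow> complex \<Rightarrow> complex^4" where
  "vec_partial_wbar G p = (\<chi> i. partial_wbar (\<lambda>q. G q $ i) p)"


section \<open>Lorentz-Minkowski space and its complexification\<close>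

(* Used at real^4 for the Lorentzian product and at complex^4 for its complex bilinear
   (not sesquilinear) extension. *)
definition mink :: "'a::comm_ring_1^4 \<Rightarrow> 'a^4 \<Rightarrow> 'a" where
  "mink p q = - (p$1 * q$1) + p$2 * q$2 + p$3 * q$3 + p$4 * q$4"

definition complexify :: "real^4 \<Rightarrow> complex^4" where
  "complexify p = (\<chi> i. complex_of_real (p$i))"

definition vec_cnj :: "complex^4 \<Rightarrow> complex^4" where
  "vec_cnj p = (\<chi> i. cnj (p$i))"

(* Causal and in the same time cone as the first basis vector. *)
definition future_directed :: "real^4 \<Rightarrow> bool" where
  "future_directed p \<longleftrightarrow> mink p p \<le> 0 \<and> p$1 > 0"

definition positively_oriented :: "real^4 \<Rightarrow> real^4 \<Rightarrow> real^4 \<Rightarrow> real^4 \<Rightarrow> bool" where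
  "positively_oriented a b c d \<longleftrightarrow> det (vector [a, b, c, d] :: real^4^4) > 0"

definition W :: "complex \<Rightarrow> complex \<Rightarrow> complex^4" where
  "W x y = vector [1 + x * cnj y, x + cnj y, - \<i> * (x - cnj y), - 1 + x * cnj y]"

lemma mink_W_W: "mink (W x y) (W x y) = 0"
  by (simp add: mink_def W_def vector_def power2_eq_square algebra_simps)

lemma mink_W_cnj_W: "mink (W x y) (vec_cnj (W x y)) = complex_of_real (2 * (cmod (x - y))\<^sup>2)"
proof -
  have "mink (W x y) (vec_cnj (W x y)) = 2 * ((x - y) * cnj (x - y))"
    by (simp add: mink_def W_def vec_cnj_def vector_def algebra_simps)
  then show ?thesis
    by (simp only: complex_norm_square of_real_mult of_real_numeral)
qed


section \<open>Timelike parametric surfaces and their Gauss maps\<close>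

definition immersion :: "complex set \<Rightarrow> (complex \<Rightarrow> real^4) \<Rightarrow> bool" where
  "immersion M f \<longleftrightarrow>
     (\<forall>p\<in>M. partial_u f p \<noteq> partial_v f p \<and> independent {partial_u f p, partial_v f p})"

definition homeo_onto_image :: "complex set \<Rightarrow> (complex \<Rightarrow> real^4) \<Rightarrow> bool" where
  "homeo_onto_image M f \<longleftrightarrow> (\<exists>g. homeomorphism M (f ` M) f g)"

(* The time-orientation convention for null coordinates; it is void for other coordinates. *)
definition null_future_convention :: "complex set \<Rightarrow> (complex \<Rightarrow> real^4) \<Rightarrow> bool" where
  "null_future_convention M f \<longleftrightarrow>
     ((\<forall>p\<in>M. mink (partial_u f p) (partial_u f p) = 0 \<and> mink (partial_v f p) (partial_v f p) = 0) \<longrightarrow>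
      (\<forall>p\<in>M. future_directed (partial_u f p) \<and> future_directed (partial_v f p)))"

(* A timelike parametric surface of the scaled de Sitter space of all p with mink p p = r. *)
definition parametric_surface :: "real \<Rightarrow> complex set \<Rightarrow> (complex \<Rightarrow> real^4) \<Rightarrow> bool" where
  "parametric_surface r M f \<longleftrightarrow>
     smooth_on M f \<and> homeo_onto_image M f \<and> immersion M f \<and>
     (\<forall>p\<in>M. mink (f p) (f p) = r) \<and>
     (\<forall>p\<in>M. mink (partial_u f p) (partial_u f p) * mink (partial_v f p) (partial_v f p)
             - (mink (partial_u f p) (partial_v f p))\<^sup>2 < 0) \<and>
     null_future_convention M f"

definition gauss_map :: "real \<Rightarrow> complex set \<Rightarrow> (complex \<Rightarrow> real^4) \<Rightarrow> (complex \<Rightarrow> real^4) \<Rightarrow> bool" where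
  "gauss_map r M f \<nu> \<longleftrightarrow>
     (\<forall>p\<in>M. mink (\<nu> p) (\<nu> p) = r \<and> mink (\<nu> p) (f p) = 0 \<and>
        mink (\<nu> p) (partial_u f p) = 0 \<and> mink (\<nu> p) (partial_v f p) = 0 \<and>
        positively_oriented (f p) (partial_u f p) (partial_v f p) (\<nu> p))"

end

theory Submission
  imports Defs
begin

text \<open>
  Put \<open>Z = \<mu> W\<close>, so that \<open>f\<close> and \<open>\<nu>\<close> are the real and imaginary parts of \<open>Z\<close>. As \<open>W\<close> is null and
  \<open>|\<mu>|\<^sup>2\<close> is normalised, \<open>\<langle>Z, Z\<rangle> = 0\<close> and \<open>\<langle>Z, cnj Z\<rangle> = 2\<close>; this says that \<open>f\<close> and \<open>\<nu>\<close> are orthogonal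
  with \<open>\<langle>f, f\<rangle> = \<langle>\<nu>, \<nu>\<rangle> = 1\<close> (lemma \<open>null_vector_orthonormal\<close>). Differentiating these constants gives
  \<open>\<langle>f, df\<rangle> = 0\<close> and \<open>\<langle>dZ, cnj Z\<rangle> = - 2 i \<langle>\<nu>, df\<rangle>\<close> (lemma \<open>null_map_derivative\<close>). Hence \<open>\<nu>\<close> is
  normal to \<open>f\<close> exactly when \<open>\<langle>dZ, cnj Z\<rangle>\<close> vanishes. Since \<open>dZ = d\<mu> W + \<mu> dW\<close>, dividing by
  \<open>\<mu> \<langle>W, cnj W\<rangle>\<close> and passing to \<open>\<partial>\<^sub>w\<close> and \<open>\<partial>\<close> with respect to the conjugate variable turns this
  condition into the two equations for \<open>\<mu>\<close> (lemma \<open>log_derivative_equations_iff\<close>).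

  Conversely, for an immersion \<open>f\<close> normality of \<open>\<nu>\<close> yields the conditions on the metric and the
  orientation, with \<open>r = 1\<close>. The Gram matrix of the frame \<open>f, f\<^sub>u, f\<^sub>v, \<nu>\<close> consists of a
  unit entry, the first fundamental form and another unit entry. Its determinant is on the one hand
  \<open>E G - F\<^sup>2\<close>, and on the other hand minus the square of the determinant of the frame, because the
  ambient metric has determinant \<open>-1\<close> (lemma \<open>gram_matrix_det\<close>). Normality and the linear
  independence of \<open>f\<^sub>u, f\<^sub>v\<close> make the frame a basis (lemma \<open>det_frame_nonzero\<close>), so the induced
  metric is Lorentzian. The frame determinant is a continuous function without zeros on a connected
  set, so its sign at a single point decides the orientation everywhere.
\<close>

section \<open>Closure properties of smooth maps\<close>

lemma Ck_on_cong:
  assumes "open S" "\<And>p. p \<in> S \<Longrightarrow> g p = h p" "Ck_on k S g"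
  shows "Ck_on k S h"
  using assms(2,3)
proof (induction k arbitrary: g h)
  case 0
  then show ?case by (simp cong: continuous_on_cong_simp)
next
  case (Suc k)
  have D: "(h has_derivative frechet_derivative g (at p)) (at p)" if "p \<in> S" for p
    using Suc.prems that assms(1)
    by (auto simp: frechet_derivative_works intro: has_derivative_transform_within_open)
  have "Ck_on k S (\<lambda>p. frechet_derivative h (at p) e)" for e
  proof (rule Suc.IH)
    show "Ck_on k S (\<lambda>p. frechet_derivative g (at p) e)" using Suc.prems by simp
    show "frechet_derivative g (at p) e = frechet_derivative h (at p) e" if "p \<in> S" for p
      using frechet_derivative_at[OF D[OF that]] by simp
  qed
  then show ?case using D by (auto simp: differentiable_def)
qed

lemma smooth_on_cong:
  assumes "open S" "\<And>p. p \<in> S \<Longrightarrow> g p = h p" "smooth_on S g"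
  shows "smooth_on S h"
  using assms Ck_on_cong unfolding smooth_on_def by blast

text \<open>
  The definition of \<open>Ck_on\<close> refers to the derivative chosen by \<open>frechet_derivative\<close>; this rule permits
  the use of any explicit formula \<open>D\<close> for the derivative, and so reduces each closure property below
  to the corresponding rule of differentiation.
\<close>

lemma Ck_on_SucI:
  assumes "open S" "\<And>p. p \<in> S \<Longrightarrow> (g has_derivative D p) (at p)"
    and "\<And>h. Ck_on k S (\<lambda>p. D p h)"
  shows "Ck_on (Suc k) S g"
proof -
  have "Ck_on k S (\<lambda>p. frechet_derivative g (at p) h)" for h
    using frechet_derivative_at[OF assms(2)]
    by (intro Ck_on_cong[OF assms(1) _ assms(3)[of h]]) simp
  then show ?thesis using assms(2) by (auto simp: differentiable_def)
qed

lemma smooth_on_imp_has_derivative: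
  assumes "smooth_on S g" "p \<in> S"
  shows "(g has_derivative frechet_derivative g (at p)) (at p)"
proof -
  have "Ck_on (Suc 0) S g" using assms(1) unfolding smooth_on_def by blast
  then show ?thesis using assms(2) by (simp add: frechet_derivative_works)
qed

lemma smooth_on_frechet_derivative:
  assumes "smooth_on S g"
  shows "smooth_on S (\<lambda>p. frechet_derivative g (at p) h)"
  unfolding smooth_on_def
proof
  fix k
  have "Ck_on (Suc k) S g" using assms unfolding smooth_on_def by blast
  then show "Ck_on k S (\<lambda>p. frechet_derivative g (at p) h)" by simp
qed

lemma smooth_on_imp_continuous_on: "smooth_on S g \<Longrightarrow> continuous_on S g"
  unfolding smooth_on_def by (metis Ck_on.simps(1))

lemma Ck_on_const: "Ck_on k S (\<lambda>p. c)"
  by (induction k arbitrary: c) auto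

lemma smooth_on_const: "smooth_on S (\<lambda>p. c)"
  by (simp add: smooth_on_def Ck_on_const)

lemma Ck_on_add:
  assumes "open S" "Ck_on k S g" "Ck_on k S h"
  shows "Ck_on k S (\<lambda>p. g p + h p)"
  using assms(2,3)
proof (induction k arbitrary: g h)
  case 0
  then show ?case by (simp add: continuous_on_add)
next
  case (Suc k)
  show ?case
    using Suc.prems
    by (intro Ck_on_SucI[OF assms(1) has_derivative_add] Suc.IH) (auto simp: frechet_derivative_works)
qed

lemma smooth_on_add:
  "open S \<Longrightarrow> smooth_on S g \<Longrightarrow> smooth_on S h \<Longrightarrow> smooth_on S (\<lambda>p. g p + h p)"
  by (simp add: smooth_on_def Ck_on_add)

lemma smooth_on_sum:
  assumes "open S" "\<And>i. i \<in> I \<Longrightarrow> smooth_on S (g i)"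
  shows "smooth_on S (\<lambda>p. \<Sum>i\<in>I. g i p)"
  using assms(2)
  by (induction I rule: infinite_finite_induct)
     (simp_all add: smooth_on_const smooth_on_add assms(1))

text \<open>
  The order \<open>k\<close> is the induction variable, but the hypothesis on the given maps is kept at infinite
  order: a derivative of a smooth map is smooth again, whereas a map of class \<open>Ck_on (Suc k)\<close>
  would first have to be shown to be of class \<open>Ck_on k\<close>.
  The product rule that follows is proved in the same way.
\<close>

lemma (in bounded_linear) smooth_on_image:
  assumes "open S" "smooth_on S g"
  shows "smooth_on S (\<lambda>p. f (g p))"
proof -
  have "Ck_on k S (\<lambda>p. f (g p))" if "smooth_on S g" for k g
    using that
  proof (induction k arbitrary: g)
    case 0
    then show ?case by (simp add: continuous_on smooth_on_imp_continuous_on)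
  next
    case (Suc k)
    then show ?case
      by (intro Ck_on_SucI[OF assms(1) has_derivative[OF smooth_on_imp_has_derivative]] Suc.IH
          smooth_on_frechet_derivative)
  qed
  then show ?thesis using assms(2) by (simp add: smooth_on_def)
qed

lemma (in bounded_bilinear) smooth_on_prod:
  assumes "open S" "smooth_on S g" "smooth_on S h"
  shows "smooth_on S (\<lambda>p. prod (g p) (h p))"
proof -
  have "Ck_on k S (\<lambda>p. prod (g p) (h p))" if "smooth_on S g" "smooth_on S h" for k g h
    using that
  proof (induction k arbitrary: g h)
    case 0
    then show ?case by (simp add: continuous_on smooth_on_imp_continuous_on)
  next
    case (Suc k)
    then show ?case
      by (intro Ck_on_SucI[OF assms(1) FDERIV[OF smooth_on_imp_has_derivative smooth_on_imp_has_derivative]]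
            Ck_on_add[OF assms(1)] Suc.IH smooth_on_frechet_derivative)
  qed
  then show ?thesis using assms(2,3) by (simp add: smooth_on_def)
qed

lemma bounded_linear_axis:
  "bounded_linear (axis i :: 'b::euclidean_space \<Rightarrow> 'b^'n)"
  unfolding linear_conv_bounded_linear[symmetric]
  by (auto intro!: linearI simp: vec_eq_iff axis_def)

lemma smooth_on_vec:
  fixes g :: "'a::real_normed_vector \<Rightarrow> 'b::euclidean_space^'n"
  assumes "open S" "\<And>i. smooth_on S (\<lambda>p. g p $ i)"
  shows "smooth_on S g"
proof -
  have "smooth_on S (\<lambda>p. \<Sum>i\<in>UNIV. axis i (g p $ i))"
    by (intro smooth_on_sum bounded_linear.smooth_on_image[OF bounded_linear_axis] assms)
  moreover have "(\<Sum>i\<in>UNIV. axis i (v $ i)) = v" for v :: "'b^'n"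
    by (simp add: vec_eq_iff axis_def if_distrib cong: if_cong)
  ultimately show ?thesis by simp
qed

section \<open>Vectors in four dimensions\<close>

lemma vector_4 [simp]:
  "(vector [a, b, c, d] :: 'a::zero^4) $ 1 = a"
  "(vector [a, b, c, d] :: 'a::zero^4) $ 2 = b"
  "(vector [a, b, c, d] :: 'a::zero^4) $ 3 = c"
  "(vector [a, b, c, d] :: 'a::zero^4) $ 4 = d"
  unfolding vector_def by simp_all

text \<open>
  The Gram matrix of two orthonormal vectors, listed first and last, and two vectors orthogonal to
  both of them has this shape. With this many zeros the Leibniz formula has only two nonzero terms.
\<close>

lemma det_4_of_block:
  fixes A :: "'a::comm_ring_1^4^4"
  assumes "A$1$1 = 1" "A$1$2 = 0" "A$1$3 = 0" "A$1$4 = 0"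
    and "A$4$1 = 0" "A$4$2 = 0" "A$4$3 = 0" "A$4$4 = 1"
    and "A$2$1 = 0" "A$2$4 = 0" "A$3$1 = 0" "A$3$4 = 0"
  shows "det A = A$2$2 * A$3$3 - A$2$3 * A$3$2"
proof -
  have f1234: "finite {2::4, 3, 4}" "1 \<notin> {2::4, 3, 4}" by auto
  have f234: "finite {3::4, 4}" "2 \<notin> {3::4, 4}" by auto
  have f34: "finite {4::4}" "3 \<notin> {4::4}" by auto
  show ?thesis
    unfolding det_def UNIV_4
    unfolding sum_over_permutations_insert[OF f1234]
    unfolding sum_over_permutations_insert[OF f234]
    unfolding sum_over_permutations_insert[OF f34]
    unfolding permutes_sing
    by (simp add: sign_swap_id permutation_swap_id sign_compose sign_id swap_id_eq assms)
qed

lemma mink_commute: "mink p q = mink q p"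
  by (simp add: mink_def mult.commute)

lemma bounded_bilinear_mink:
  "bounded_bilinear (mink :: real^4 \<Rightarrow> real^4 \<Rightarrow> real)"
  unfolding bilinear_conv_bounded_bilinear[symmetric] bilinear_def
  by (auto intro!: linearI simp: mink_def algebra_simps)

text \<open>
  The Gram matrix is \<open>A J A\<^sup>T\<close>, where the rows of \<open>A\<close> are the four vectors and \<open>J\<close> is the matrix of the
  Lorentzian product, and \<open>det J = -1\<close>. The minus sign forces an independent pair orthogonal to a
  spacelike plane to span a Lorentzian plane.
\<close>

lemma gram_matrix_det:
  fixes a b c d :: "real^4"
  assumes "mink a a = 1" "mink d d = 1" "mink a b = 0" "mink a c = 0" "mink a d = 0"
    and "mink d b = 0" "mink d c = 0"
  shows "mink b b * mink c c - (mink b c)\<^sup>2 = - (det (vector [a, b, c, d] :: real^4^4))\<^sup>2"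
proof -
  let ?A = "vector [a, b, c, d] :: real^4^4"
  let ?J = "(\<chi> i j. if i = j then (if i = 1 then -1 else 1) else 0) :: real^4^4"
  let ?G = "?A ** ?J ** transpose ?A"
  have G: "?G $ i $ j = mink (?A $ i) (?A $ j)" for i j
    by (simp add: matrix_matrix_mult_def transpose_def mink_def sum_4)
  have "det ?J = (\<Prod>i\<in>UNIV. ?J $ i $ i)"
    by (rule det_diagonal) simp
  also have "\<dots> = -1"
    unfolding UNIV_4 by simp
  finally have "det ?G = - (det ?A)\<^sup>2"
    by (simp only: det_mul det_transpose power2_eq_square mult_minus1_right mult_minus_left)
  moreover have "det ?G = mink b b * mink c c - mink b c * mink c b"
    by (subst det_4_of_block) (simp_all add: G assms assms(6,7)[unfolded mink_commute[of d]] mink_commute)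
  ultimately show ?thesis by (simp add: mink_commute power2_eq_square)
qed

text \<open>
  Taking products with \<open>a\<close> and with \<open>d\<close> isolates their coefficients in a linear relation among the
  four vectors; what remains is a relation between \<open>b\<close> and \<open>c\<close>.
\<close>

lemma det_frame_nonzero:
  fixes a b c d :: "real^4"
  assumes "mink a a = 1" "mink d d = 1" "mink a b = 0" "mink a c = 0" "mink a d = 0"
    and "mink d b = 0" "mink d c = 0"
    and "b \<noteq> c" "independent {b, c}"
  shows "det (vector [a, b, c, d] :: real^4^4) \<noteq> 0"
proof -
  let ?A = "vector [a, b, c, d] :: real^4^4"
  have "k i = 0" if sum0: "(\<Sum>i\<in>UNIV. k i *s row i ?A) = 0" for k :: "4 \<Rightarrow> real" and i
  proof -
    have row: "row 1 ?A = a" "row 2 ?A = b" "row 3 ?A = c" "row 4 ?A = d"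
      by (simp_all add: row_def)
    have eq: "k 1 *s a + k 2 *s b + k 3 *s c + k 4 *s d = 0" (is "?v = 0")
      using sum0 by (simp add: sum_4 row)
    have lin: "mink e ?v = k 1 * mink e a + k 2 * mink e b + k 3 * mink e c + k 4 * mink e d" for e
      by (simp add: mink_def algebra_simps)
    have z: "mink e ?v = 0" for e unfolding eq by (simp add: mink_def)
    have "k 1 = 0" "k 4 = 0"
      using z[of a] z[of d] unfolding lin by (simp_all add: assms mink_commute[of d a])
    moreover have "k 2 = 0 \<and> k 3 = 0"
    proof -
      have "(\<Sum>v\<in>{b, c}. (if v = b then k 2 else k 3) *\<^sub>R v) = 0"
        using eq \<open>b \<noteq> c\<close> \<open>k 1 = 0\<close> \<open>k 4 = 0\<close> by (auto simp: scalar_mult_eq_scaleR)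
      then show ?thesis
        using \<open>independent {b, c}\<close> \<open>b \<noteq> c\<close> unfolding independent_explicit by fastforce
    qed
    ultimately show ?thesis using exhaust_4[of i] by auto
  qed
  then show ?thesis
    using matrix_right_invertible_independent_rows[of ?A] invertible_right_inverse[of ?A]
      invertible_det_nz[of ?A] by blast
qed

lemma continuous_on_det:
  fixes A :: "'a::topological_space \<Rightarrow> real^'n^'n"
  assumes "continuous_on S A"
  shows "continuous_on S (\<lambda>p. det (A p))"
  unfolding det_def by (intro continuous_intros assms)


lemma bounded_bilinear_vector_scalar_mult:
  "bounded_bilinear ((*s) :: complex \<Rightarrow> complex^'n \<Rightarrow> complex^'n)"
  unfolding bilinear_conv_bounded_bilinear[symmetric] bilinear_def
  by (auto intro!: linearI simp: vec_eq_iff algebra_simps)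

lemma mink_add_left: "mink (p + q) r = mink p r + mink q r"
  by (simp add: mink_def algebra_simps)

lemma mink_smult: "mink (a *s p) q = a * mink p q" "mink p (a *s q) = a * mink p q"
  by (simp_all add: mink_def algebra_simps)

section \<open>Real and imaginary parts of complex vectors\<close>

definition vec_Re :: "complex^4 \<Rightarrow> real^4" where
  "vec_Re z = (\<chi> i. Re (z $ i))"

definition vec_Im :: "complex^4 \<Rightarrow> real^4" where
  "vec_Im z = (\<chi> i. Im (z $ i))"

lemma bounded_linear_vec_Re: "bounded_linear vec_Re"
  and bounded_linear_vec_Im: "bounded_linear vec_Im"
  unfolding linear_conv_bounded_linear[symmetric]
  by (auto intro!: linearI simp: vec_eq_iff vec_Re_def vec_Im_def)

lemma Re_mink: "Re (mink z w) = mink (vec_Re z) (vec_Re w) - mink (vec_Im z) (vec_Im w)"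
  and Im_mink: "Im (mink z w) = mink (vec_Re z) (vec_Im w) + mink (vec_Im z) (vec_Re w)"
  by (simp_all add: mink_def vec_Re_def vec_Im_def algebra_simps)

lemma vec_Re_vec_cnj [simp]: "vec_Re (vec_cnj z) = vec_Re z"
  and vec_Im_vec_cnj [simp]: "vec_Im (vec_cnj z) = - vec_Im z"
  by (simp_all add: vec_eq_iff vec_Re_def vec_Im_def vec_cnj_def)

lemma vec_cnj_smult: "vec_cnj (a *s z) = cnj a *s vec_cnj z"
  by (simp add: vec_eq_iff vec_cnj_def)

lemma mink_minus_right: "mink p (- q) = - mink p q"
  by (simp add: mink_def)

lemma complexify_eq_half_sum_iff:
  "complexify a = (1 / 2) *s (z + vec_cnj z) \<longleftrightarrow> a = vec_Re z"
  by (auto simp: vec_eq_iff complexify_def vec_cnj_def vec_Re_def complex_eq_iff)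

lemma complexify_eq_half_diff_iff:
  "complexify a = (1 / (2 * \<i>)) *s (z - vec_cnj z) \<longleftrightarrow> a = vec_Im z"
  by (auto simp: vec_eq_iff complexify_def vec_cnj_def vec_Im_def complex_eq_iff)

text \<open>
  The real part of \<open>\<langle>z, z\<rangle>\<close> is the difference, and the real part of \<open>\<langle>z, cnj z\<rangle>\<close> the sum, of the
  squares of the real and imaginary vectors; twice their product is the imaginary part of \<open>\<langle>z, z\<rangle>\<close>.
\<close>

lemma null_vector_orthonormal:
  assumes "mink z z = 0" "mink z (vec_cnj z) = 2"
  shows "mink (vec_Re z) (vec_Re z) = 1" "mink (vec_Im z) (vec_Im z) = 1"
    and "mink (vec_Re z) (vec_Im z) = 0"
  using Re_mink[of z z] Im_mink[of z z] Re_mink[of z "vec_cnj z"] assms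
  by (simp_all add: mink_minus_right mink_commute)

lemma mink_derivative_of_constant:
  fixes a b :: "'a::real_normed_vector \<Rightarrow> real^4"
  assumes "open S" "p \<in> S" "\<And>q. q \<in> S \<Longrightarrow> mink (a q) (b q) = c"
    and "(a has_derivative a') (at p)" "(b has_derivative b') (at p)"
  shows "mink (a p) (b' h) + mink (a' h) (b p) = 0"
proof -
  have "((\<lambda>q. mink (a q) (b q)) has_derivative (\<lambda>h. mink (a p) (b' h) + mink (a' h) (b p))) (at p)"
    by (rule bounded_bilinear.FDERIV[OF bounded_bilinear_mink assms(4,5)])
  moreover have "((\<lambda>q. mink (a q) (b q)) has_derivative (\<lambda>h. 0)) (at p)"
    using assms(1-3) by (intro has_derivative_transform_within_open[OF has_derivative_const, of S]) auto
  ultimately show ?thesis by (metis has_derivative_unique)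
qed

text \<open>
  Write \<open>Z = f + i \<nu>\<close>. The products \<open>\<langle>f, f\<rangle>\<close>, \<open>\<langle>\<nu>, \<nu>\<rangle>\<close> and \<open>\<langle>f, \<nu>\<rangle>\<close> are constant, so \<open>\<langle>f, df\<rangle>\<close> and
  \<open>\<langle>\<nu>, d\<nu>\<rangle>\<close> vanish and \<open>\<langle>f, d\<nu>\<rangle> = - \<langle>\<nu>, df\<rangle>\<close>. Of the four real products in \<open>\<langle>dZ, cnj Z\<rangle>\<close> only
  the two mixed ones survive, and they are equal: the complex number \<open>\<langle>dZ, cnj Z\<rangle>\<close> measures precisely
  how far \<open>\<nu>\<close> is from being normal to \<open>f\<close>.
\<close>

lemma null_map_derivative:
  fixes Z :: "complex \<Rightarrow> complex^4"
  assumes S: "open S" "p \<in> S"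
    and null: "\<And>q. q \<in> S \<Longrightarrow> mink (Z q) (Z q) = 0"
    and unit: "\<And>q. q \<in> S \<Longrightarrow> mink (Z q) (vec_cnj (Z q)) = 2"
    and D: "(Z has_derivative D) (at p)"
  shows "mink (vec_Re (Z p)) (vec_Re (D h)) = 0"
    and "mink (D h) (vec_cnj (Z p)) = complex_of_real (mink (vec_Im (Z p)) (vec_Re (D h))) * (- 2 * \<i>)"
proof -
  note ortho = null_vector_orthonormal[OF null unit]
  note DRe = bounded_linear.has_derivative[OF bounded_linear_vec_Re D]
  note DIm = bounded_linear.has_derivative[OF bounded_linear_vec_Im D]
  have rr: "2 * mink (vec_Re (Z p)) (vec_Re (D h)) = 0"
    using mink_derivative_of_constant[OF S ortho(1) DRe DRe, of h]
    by (simp add: mink_commute)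
  have ii: "2 * mink (vec_Im (Z p)) (vec_Im (D h)) = 0"
    using mink_derivative_of_constant[OF S ortho(2) DIm DIm, of h]
    by (simp add: mink_commute)
  have ri: "mink (vec_Re (Z p)) (vec_Im (D h)) = - mink (vec_Im (Z p)) (vec_Re (D h))"
    using mink_derivative_of_constant[OF S ortho(3) DRe DIm, of h]
    by (simp add: mink_commute)
  show "mink (vec_Re (Z p)) (vec_Re (D h)) = 0" using rr by simp
  show "mink (D h) (vec_cnj (Z p)) = complex_of_real (mink (vec_Im (Z p)) (vec_Re (D h))) * (- 2 * \<i>)"
    using rr ii ri
    by (simp add: complex_eq_iff Re_mink Im_mink mink_minus_right
        mink_commute)
qed

section \<open>Wirtinger derivatives\<close>

lemma partial_component:
  fixes G :: "complex \<Rightarrow> complex^4"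
  assumes "(G has_derivative D) (at p)"
  shows "partial_u (\<lambda>q. G q $ i) p = D 1 $ i" "partial_v (\<lambda>q. G q $ i) p = D \<i> $ i"
  using frechet_derivative_at[OF bounded_linear.has_derivative[OF bounded_linear_vec_nth assms, of i]]
  by (simp_all add: partial_u_def partial_v_def fun_eq_iff)

lemma mink_vec_partial:
  assumes "(G has_derivative D) (at p)"
  shows "mink (vec_partial_w G p) c = (mink (D 1) c - \<i> * mink (D \<i>) c) / 2"
    and "mink (vec_partial_wbar G p) c = (mink (D 1) c + \<i> * mink (D \<i>) c) / 2"
  unfolding vec_partial_w_def vec_partial_wbar_def partial_w_def partial_wbar_def
    partial_component[OF assms]
  by (simp_all add: mink_def field_simps)

text \<open>
  Here \<open>a\<close> and \<open>b\<close> are the values of a real linear map at \<open>1\<close> and \<open>\<i>\<close>. Complex values are allowed, so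
  neither combination alone determines both, but the pair does.
\<close>

lemma wirtinger_pair_zero_iff:
  fixes a b :: complex
  shows "a - \<i> * b = 0 \<and> a + \<i> * b = 0 \<longleftrightarrow> a = 0 \<and> b = 0"
proof -
  have "2 * a = (a - \<i> * b) + (a + \<i> * b)" "2 * \<i> * b = (a + \<i> * b) - (a - \<i> * b)"
    by (simp_all add: algebra_simps)
  then show ?thesis by auto
qed

text \<open>
  Cleared of denominators, each equation states that a Wirtinger combination of the values at \<open>1\<close> and
  \<open>\<i>\<close> of \<open>h \<mapsto> \<langle>d(m G) h, c\<rangle>\<close> vanishes.
\<close>

lemma log_derivative_equations_iff:
  fixes m :: "complex \<Rightarrow> complex" and G :: "complex \<Rightarrow> complex^4"
  assumes dm: "(m has_derivative m') (at p)" and dG: "(G has_derivative G') (at p)"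
    and "m p \<noteq> 0" "mink (G p) c \<noteq> 0"
  shows "partial_w m p / m p = - mink (vec_partial_w G p) c / mink (G p) c
      \<and> partial_wbar m p / m p = - mink (vec_partial_wbar G p) c / mink (G p) c
    \<longleftrightarrow> (\<forall>h\<in>{1, \<i>}. mink (m' h *s G p + m p *s G' h) c = 0)" (is "?l \<longleftrightarrow> ?r")
proof -
  define A where "A h = m' h * mink (G p) c + m p * mink (G' h) c" for h
  have p: "partial_w m p = (m' 1 - \<i> * m' \<i>) / 2" "partial_wbar m p = (m' 1 + \<i> * m' \<i>) / 2"
    using frechet_derivative_at[OF dm]
    by (simp_all add: partial_w_def partial_wbar_def partial_u_def partial_v_def)
  have quotients: "a / 2 / m p = - (b / 2) / mink (G p) c
      \<longleftrightarrow> a * mink (G p) c + m p * b = 0" for a b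
  proof -
    have "a / 2 / m p = - (b / 2) / mink (G p) c \<longleftrightarrow> a * mink (G p) c = - (m p * b)"
      using assms(3,4) by (simp add: field_simps)
    then show ?thesis by (simp add: eq_neg_iff_add_eq_0)
  qed
  have "?l \<longleftrightarrow> A 1 - \<i> * A \<i> = 0 \<and> A 1 + \<i> * A \<i> = 0"
    unfolding p mink_vec_partial[OF dG] quotients A_def by (simp add: algebra_simps)
  also have "\<dots> \<longleftrightarrow> A 1 = 0 \<and> A \<i> = 0"
    by (rule wirtinger_pair_zero_iff)
  also have "\<dots> \<longleftrightarrow> ?r" by (simp add: A_def mink_add_left mink_smult)
  finally show ?thesis .
qed

section \<open>The Gauss map\<close>

lemma smooth_on_W:
  assumes "open S" "smooth_on S x" "smooth_on S y"
  shows "smooth_on S (\<lambda>p. W (x p) (y p))"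
proof (rule smooth_on_vec[OF \<open>open S\<close>])
  note cnj_y = bounded_linear.smooth_on_image[OF bounded_linear_cnj assms(1,3)]
  note mult = bounded_bilinear.smooth_on_prod[OF bounded_bilinear_mult assms(1)]
  note rules = smooth_on_add[OF assms(1)] smooth_on_const mult assms(2) cnj_y
  fix i :: 4
  have "smooth_on S (\<lambda>p. 1 + x p * cnj (y p))" "smooth_on S (\<lambda>p. x p + cnj (y p))"
    "smooth_on S (\<lambda>p. - \<i> * x p + \<i> * cnj (y p))" "smooth_on S (\<lambda>p. - 1 + x p * cnj (y p))"
    by (intro rules)+
  then show "smooth_on S (\<lambda>p. W (x p) (y p) $ i)"
    using exhaust_4[of i] by (auto simp: W_def algebra_simps)
qed

lemma positive_on_connected:
  fixes g :: "'a::topological_space \<Rightarrow> real"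
  assumes "connected S" "continuous_on S g" "\<And>p. p \<in> S \<Longrightarrow> g p \<noteq> 0"
    and "a \<in> S" "g a > 0" "b \<in> S"
  shows "g b > 0"
proof (rule ccontr)
  assume "\<not> g b > 0"
  moreover have "connected (g ` S)" using assms by (simp add: connected_continuous_image)
  ultimately have "0 \<in> g ` S"
    using assms(4-6) connectedD_interval[of "g ` S" "g b" "g a" 0] by auto
  then show False using assms(3) by auto
qed

theorem lemma5p1:
  fixes M :: "complex set"
    and x y \<mu> :: "complex \<Rightarrow> complex"
    and f \<nu> :: "complex \<Rightarrow> real^4"
  assumes M: "open M" "connected M" "simply_connected M"
    and smooth: "smooth_on M x" "smooth_on M y" "smooth_on M \<mu>"
    and neq: "\<forall>w\<in>M. x w \<noteq> y w"
    and f_eq: "\<forall>w\<in>M. complexify (f w)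
                  = (1 / 2) *s (\<mu> w *s W (x w) (y w) + cnj (\<mu> w) *s vec_cnj (W (x w) (y w)))"
    and normalization:
      "\<forall>w\<in>M. complex_of_real ((cmod (\<mu> w))\<^sup>2) * mink (W (x w) (y w)) (vec_cnj (W (x w) (y w))) = 2"
    and nu_eq: "\<forall>w\<in>M. complexify (\<nu> w)
                  = (1 / (2 * \<i>)) *s (\<mu> w *s W (x w) (y w) - cnj (\<mu> w) *s vec_cnj (W (x w) (y w)))"
    and nu_nonconstant: "\<not> \<nu> constant_on M"
    and regular: "immersion M f" "homeo_onto_image M f" "null_future_convention M f"
    and orientation:
      "\<exists>p\<in>M. positively_oriented (f p) (partial_u f p) (partial_v f p) (\<nu> p)"
  shows "(\<exists>r>0. parametric_surface r M f \<and> gauss_map r M f \<nu>) \<longleftrightarrow>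
         (\<forall>w\<in>M. partial_w \<mu> w / \<mu> w
                   = - mink (vec_partial_w (\<lambda>z. W (x z) (y z)) w) (vec_cnj (W (x w) (y w)))
                       / mink (W (x w) (y w)) (vec_cnj (W (x w) (y w)))
               \<and> partial_wbar \<mu> w / \<mu> w
                   = - mink (vec_partial_wbar (\<lambda>z. W (x z) (y z)) w) (vec_cnj (W (x w) (y w)))
                       / mink (W (x w) (y w)) (vec_cnj (W (x w) (y w))))"
proof -
  let ?G = "\<lambda>p. W (x p) (y p)"
  define Z where "Z p = \<mu> p *s ?G p" for p
  have f: "f p = vec_Re (Z p)" and nu: "\<nu> p = vec_Im (Z p)" if "p \<in> M" for p
    using f_eq nu_eq that
    unfolding Z_def complexify_eq_half_sum_iff[symmetric] complexify_eq_half_diff_iff[symmetric]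
      vec_cnj_smult by blast+
  have null: "mink (Z p) (Z p) = 0" for p
    by (simp add: Z_def mink_smult mink_W_W)
  have unit: "mink (Z p) (vec_cnj (Z p)) = 2" if "p \<in> M" for p
    using bspec[OF normalization that] unfolding complex_norm_square
    by (simp add: Z_def vec_cnj_smult mink_smult ac_simps)
  have ortho: "mink (f p) (f p) = 1" "mink (\<nu> p) (\<nu> p) = 1" "mink (f p) (\<nu> p) = 0" if "p \<in> M" for p
    using null_vector_orthonormal[OF null unit[OF that]] f[OF that] nu[OF that] by simp_all
  have smooth_G: "smooth_on M ?G"
    using smooth_on_W M(1) smooth(1,2) .
  have smooth_Z: "smooth_on M Z"
    unfolding Z_def
    by (rule bounded_bilinear.smooth_on_prod[OF bounded_bilinear_vector_scalar_mult M(1) smooth(3) smooth_G])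
  have smooth_f: "smooth_on M f"
    using f by (intro smooth_on_cong[OF M(1) _ bounded_linear.smooth_on_image[OF bounded_linear_vec_Re M(1) smooth_Z]]) simp
  have smooth_nu: "smooth_on M \<nu>"
    using nu by (intro smooth_on_cong[OF M(1) _ bounded_linear.smooth_on_image[OF bounded_linear_vec_Im M(1) smooth_Z]]) simp
  define D where "D p h = frechet_derivative \<mu> (at p) h *s ?G p + \<mu> p *s frechet_derivative ?G (at p) h" for p h
  have dZ: "(Z has_derivative D p) (at p)" if "p \<in> M" for p
    using bounded_bilinear.FDERIV[OF bounded_bilinear_vector_scalar_mult
        smooth_on_imp_has_derivative[OF smooth(3) that] smooth_on_imp_has_derivative[OF smooth_G that]]
    unfolding Z_def[symmetric] D_def[abs_def] by (simp add: add.commute)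
  have df: "partial_u f p = vec_Re (D p 1)" "partial_v f p = vec_Re (D p \<i>)" if "p \<in> M" for p
  proof -
    have "(f has_derivative (\<lambda>h. vec_Re (D p h))) (at p)"
      using bounded_linear.has_derivative[OF bounded_linear_vec_Re dZ[OF that]] f
      by (auto intro: has_derivative_transform_within_open[OF _ M(1) that])
    from frechet_derivative_at[OF this]
    show "partial_u f p = vec_Re (D p 1)" "partial_v f p = vec_Re (D p \<i>)"
      by (simp_all add: partial_u_def partial_v_def fun_eq_iff)
  qed
  have tangent: "mink (f p) (partial_u f p) = 0" "mink (f p) (partial_v f p) = 0" if "p \<in> M" for p
    using null_map_derivative(1)[OF M(1) that null unit dZ[OF that]] f[OF that] df[OF that] by simp_all
  have equations_iff:
    "(partial_w \<mu> p / \<mu> p = - mink (vec_partial_w ?G p) (vec_cnj (?G p)) / mink (?G p) (vec_cnj (?G p))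
      \<and> partial_wbar \<mu> p / \<mu> p = - mink (vec_partial_wbar ?G p) (vec_cnj (?G p)) / mink (?G p) (vec_cnj (?G p)))
     \<longleftrightarrow> mink (\<nu> p) (partial_u f p) = 0 \<and> mink (\<nu> p) (partial_v f p) = 0" (is "?eqs \<longleftrightarrow> _") if "p \<in> M" for p
  proof -
    have nz: "\<mu> p \<noteq> 0" "mink (?G p) (vec_cnj (?G p)) \<noteq> 0"
      using bspec[OF normalization that] by auto
    have "?eqs \<longleftrightarrow> (\<forall>h\<in>{1, \<i>}. mink (D p h) (vec_cnj (?G p)) = 0)"
      unfolding D_def
      by (rule log_derivative_equations_iff[OF smooth_on_imp_has_derivative[OF smooth(3) that]
            smooth_on_imp_has_derivative[OF smooth_G that] nz])
    also have "\<dots> \<longleftrightarrow> (\<forall>h\<in>{1, \<i>}. mink (D p h) (vec_cnj (Z p)) = 0)"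
      using nz by (simp add: Z_def vec_cnj_smult mink_smult)
    also have "\<dots> \<longleftrightarrow> mink (\<nu> p) (partial_u f p) = 0 \<and> mink (\<nu> p) (partial_v f p) = 0"
      using null_map_derivative(2)[OF M(1) that null unit dZ[OF that]] nu[OF that] df[OF that] by simp
    finally show ?thesis .
  qed
  have "(\<exists>r>0. parametric_surface r M f \<and> gauss_map r M f \<nu>)
    \<longleftrightarrow> (\<forall>p\<in>M. mink (\<nu> p) (partial_u f p) = 0 \<and> mink (\<nu> p) (partial_v f p) = 0)" (is "?l \<longleftrightarrow> ?r")
  proof
    assume ?l
    then show ?r by (auto simp: gauss_map_def)
  next
    assume normal: ?r
    \<comment> \<open>The surface lies in the unit hyperquadric; only the metric and the orientation are at stake.\<close>
    define d where "d p = det (vector [f p, partial_u f p, partial_v f p, \<nu> p] :: real^4^4)" for p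
    have indep: "partial_u f p \<noteq> partial_v f p" "independent {partial_u f p, partial_v f p}" if "p \<in> M" for p
      using regular(1) that by (auto simp: immersion_def)
    note frame = ortho(1,2) tangent ortho(3)
    have nz: "d p \<noteq> 0" if "p \<in> M" for p
      unfolding d_def using frame[OF that] indep[OF that] normal that
      by (intro det_frame_nonzero) auto
    have gram: "mink (partial_u f p) (partial_u f p) * mink (partial_v f p) (partial_v f p)
             - (mink (partial_u f p) (partial_v f p))\<^sup>2 = - (d p)\<^sup>2" if "p \<in> M" for p
      unfolding d_def using frame[OF that] normal that by (intro gram_matrix_det) auto
    have "continuous_on M (\<lambda>p. (vector [f p, partial_u f p, partial_v f p, \<nu> p] :: real^4^4) $ i)" for i
      using exhaust_4[of i] smooth_f smooth_nu smooth_on_frechet_derivative[OF smooth_f]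
      by (auto simp: partial_u_def partial_v_def smooth_on_imp_continuous_on)
    then have "continuous_on M (\<lambda>p. \<chi> i. (vector [f p, partial_u f p, partial_v f p, \<nu> p] :: real^4^4) $ i)"
      by (rule continuous_on_vec_lambda)
    then have "continuous_on M d"
      unfolding d_def[abs_def] by (intro continuous_on_det) simp
    moreover obtain a where "a \<in> M" "d a > 0"
      using orientation unfolding positively_oriented_def d_def by blast
    ultimately have "d p > 0" if "p \<in> M" for p
      using positive_on_connected[of M d a p] M(2) nz that by blast
    then have "gauss_map 1 M f \<nu>"
      using normal frame by (auto simp: gauss_map_def positively_oriented_def d_def mink_commute)
    moreover have "parametric_surface 1 M f"
      using smooth_f regular ortho(1) gram nz by (simp add: parametric_surface_def)
    ultimately show ?l by (intro exI[of _ 1]) simp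
  qed
  then show ?thesis using equations_iff by simp
qed

end
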